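(* Consider the plant $\dot x=f(x,u)$, $y=g(x)$, the cost $\Phi$, and the steady-state maps $s,h$ as in the context, satisfying the plant assumption and the cost assumption stated there. Let $u^\star$ be a critical point of $\tilde\Phi$ and $x^\star=s(u^\star)$. Assume that there exist constants $c_1,d_1,\mu_1,\theta_1,c_2,d_2,\mu_2,\theta_2,\xi>0$ and continuously differentiable functions $V_x:\mathbb{R}^n\to\mathbb{R}_{\ge0}$ and $V_u:\mathbb{R}^m\to\mathbb{R}_{\ge0}$ such that, for all $x\in\mathbb{R}^n$ and $u\in\mathbb{R}^m$, $$c_1\|x-x^\star\|^2\le V_x(x)\le d_1\|x-x^\star\|^2,\qquad c_2\|u-u^\star\|^2\le V_u(u)\le d_2\|u-u^\star\|^2,$$ and moreover: (i) for all $x,u$: $\ \nabla V_x(x)^\top f(x,u)\le -\mu_1V_x(x)+\theta_1V_u(u)$; (ii) for all $x,u$: $\ -\nabla V_u(u)^\top \tilde H(u)\nabla\Phi(u,g(x))\le -\mu_2V_u(u)+\theta_2V_x(x)$; (iii) $-\mu_1+\xi\theta_1<0$ and $\theta_2-\xi\mu_2<0$. Then, for any $\alpha>0$, the closed-loop system $$\dot x=f(x,u),\qquad \dot u=-\alpha\tilde H(u)\nabla\Phi(u,g(x))$$ is globally exponentially stable (with respect to the equilibrium $(x^\star,u^\star)$), and, along every solution, $(u,y)$ with $y=g(x)$ converges to the unique solution $(u^\star,y^\star)$ of $$\min_{u\in\mathbb{R}^m,\,y\in\mathbb{R}^p}\Phi(u,y)\quad\text{s.t. } y=h(u).$$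
   Context: Plant: $\dot x=f(x,u)$, $y=g(x)$, with state $x\in\mathbb{R}^n$, input $u\in\mathbb{R}^m$, output $y\in\mathbb{R}^p$. Plant assumption: $f:\mathbb{R}^n\times\mathbb{R}^m\to\mathbb{R}^n$ and $g:\mathbb{R}^n\to\mathbb{R}^p$ are locally Lipschitz. For any constant input $u(t)=u\in\mathbb{R}^m$ the plant is globally asymptotically stable; hence there are a unique steady-state map $s:\mathbb{R}^m\to\mathbb{R}^n$ and a steady-state output map $h:\mathbb{R}^m\to\mathbb{R}^p$ with $f(s(u),u)=0$ and $h(u):=g(s(u))$ for all $u\in\mathbb{R}^m$. Furthermore, $h$ is continuously differentiable and its Jacobian $\nabla h:\mathbb{R}^m\to\mathbb{R}^{p\times m}$ is locally Lipschitz. Cost assumption: $\Phi:\mathbb{R}^m\times\mathbb{R}^p\to\mathbb{R}$ is continuously differentiable with locally Lipschitz gradient $\nabla\Phi$, and the problem $\min_{u,y}\Phi(u,y)$ s.t. $y=h(u)$ admits a solution. Notation: $\tilde\Phi(u):=\Phi(u,h(u))$; a critical point of $\tilde\Phi$ is a $u$ with $\nabla\tilde\Phi(u)=0$. $\tilde H(u):=\begin{bmatrix} I_m & \nabla h(u)^\top\end{bmatrix}$, so that $\tilde H(u)\nabla\Phi(u,y)=\nabla_u\Phi(u,y)+\nabla h(u)^\top\nabla_y\Phi(u,y)$ and $\nabla\tilde\Phi(u)=\tilde H(u)\nabla\Phi(u,h(u))$. $\|\cdot\|$ is the Euclidean norm. Conditions (i) and (ii) are bounds on the Lie derivatives of $V_x,V_u$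 along the closed loop (in (ii), the common factor $\alpha>0$ is divided out on both sides). Globally exponentially stable means: for every initial condition the solution is unique and defined for all $t\ge0$, and there are constants $K,\sigma>0$ such that $\|(x(t),u(t))-(x^\star,u^\star)\|\le Ke^{-\sigma t}\|(x(0),u(0))-(x^\star,u^\star)\|$ for all $t\ge0$ and all initial conditions. *)

theory Defs
  imports "HOL-Analysis.Analysis"
begin

section \<open>Regularity\<close>

definition locally_lipschitz :: "('a::metric_space \<Rightarrow> 'b::metric_space) \<Rightarrow> bool" where
  "locally_lipschitz f \<longleftrightarrow> (\<forall>x. \<exists>e>0. \<exists>L. L-lipschitz_on (cball x e) f)"

definition continuously_differentiable ::
  "('a::real_normed_vector \<Rightarrow> 'b::real_normed_vector) \<Rightarrow> bool" where
  "continuously_differentiable f \<longleftrightarrow>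
     (\<exists>f' :: 'a \<Rightarrow> 'a \<Rightarrow>\<^sub>L 'b.
        (\<forall>x. (f has_derivative blinfun_apply (f' x)) (at x)) \<and> continuous_on UNIV f')"

text \<open>Only meaningful at points of differentiability, where the gradient is unique
  (lemma \<open>gradient_eqI\<close> below). On a product space it is the stacked vector
  of the two partial gradients.\<close>

definition gradient :: "('a::real_inner \<Rightarrow> real) \<Rightarrow> 'a \<Rightarrow> 'a" where
  "gradient f x = (THE D. GDERIV f x :> D)"

lemma gradient_eqI:
  assumes "GDERIV f x :> D"
  shows "gradient f x = D"
  unfolding gradient_def
proof (rule the_equality)
  show "GDERIV f x :> D" by (fact assms)
next
  fix D' assume "GDERIV f x :> D'"
  with assms have "(\<lambda>h. inner h D') = (\<lambda>h. inner h D)"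
    unfolding gderiv_def by (rule has_derivative_unique[rotated])
  then have "inner (D' - D) (D' - D) = 0"
    by (metis inner_diff_right right_minus_eq)
  then show "D' = D" by simp
qed

section \<open>Autonomous differential equations and stability\<close>

definition solution_on :: "('a::real_normed_vector \<Rightarrow> 'a) \<Rightarrow> real set \<Rightarrow> (real \<Rightarrow> 'a) \<Rightarrow> bool" where
  "solution_on F I x \<longleftrightarrow> (\<forall>t\<in>I. (x has_vector_derivative F (x t)) (at t within I))"

text \<open>A solution starting in \<open>x0\<close> exists for all nonnegative times, and every
  solution starting in \<open>x0\<close>, on whatever time interval it is defined, is a restriction of it.\<close>

definition unique_global_solution :: "('a::real_normed_vector \<Rightarrow> 'a) \<Rightarrow> 'a \<Rightarrow> bool" where
  "unique_global_solution F x0 \<longleftrightarrow>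
     (\<exists>x. solution_on F {0..} x \<and> x 0 = x0 \<and>
        (\<forall>I z. is_interval I \<and> 0 \<in> I \<and> I \<subseteq> {0..} \<and> solution_on F I z \<and> z 0 = x0
           \<longrightarrow> (\<forall>t\<in>I. z t = x t)))"

definition globally_asymptotically_stable ::
  "('a::real_normed_vector \<Rightarrow> 'a) \<Rightarrow> 'a \<Rightarrow> bool" where
  "globally_asymptotically_stable F e \<longleftrightarrow>
     F e = 0 \<and>
     (\<forall>x0. unique_global_solution F x0) \<and>
     (\<forall>\<epsilon>>0. \<exists>\<delta>>0. \<forall>x. solution_on F {0..} x \<and> norm (x 0 - e) < \<delta>
        \<longrightarrow> (\<forall>t\<ge>0. norm (x t - e) < \<epsilon>)) \<and>
     (\<forall>x. solution_on F {0..} x \<longrightarrow> (x \<longlongrightarrow> e) at_top)"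

definition globally_exponentially_stable ::
  "('a::real_normed_vector \<Rightarrow> 'a) \<Rightarrow> 'a \<Rightarrow> bool" where
  "globally_exponentially_stable F e \<longleftrightarrow>
     F e = 0 \<and>
     (\<forall>x0. unique_global_solution F x0) \<and>
     (\<exists>K>0. \<exists>\<sigma>>0. \<forall>x. solution_on F {0..} x
        \<longrightarrow> (\<forall>t\<ge>0. norm (x t - e) \<le> K * exp (- \<sigma> * t) * norm (x 0 - e)))"

section \<open>Plant, cost and closed loop\<close>

text \<open>Pairs carry the Euclidean norm and inner product, so \<open>\<real>\<^sup>n \<times> \<real>\<^sup>m\<close> is used for the
  stacked vectors. Since an equilibrium that is globally attractive is unique, the
  stability clause determines \<open>s\<close>.\<close>

definition plant_assumption ::
  "((real^'n) \<times> (real^'m) \<Rightarrow> real^'n) \<Rightarrow> (real^'n \<Rightarrow> real^'p) \<Rightarrow>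
   (real^'m \<Rightarrow> real^'n) \<Rightarrow> (real^'m \<Rightarrow> real^'p) \<Rightarrow> bool" where
  "plant_assumption f g s h \<longleftrightarrow>
     locally_lipschitz f \<and> locally_lipschitz g \<and>
     (\<forall>u. globally_asymptotically_stable (\<lambda>x. f (x, u)) (s u)) \<and>
     (\<forall>u. h u = g (s u)) \<and>
     continuously_differentiable h \<and>
     locally_lipschitz (\<lambda>u. jacobian h (at u))"

definition is_solution ::
  "((real^'m) \<times> (real^'p) \<Rightarrow> real) \<Rightarrow> (real^'m \<Rightarrow> real^'p) \<Rightarrow> (real^'m) \<times> (real^'p) \<Rightarrow> bool" where
  "is_solution \<Phi> h z \<longleftrightarrow> is_arg_min \<Phi> (\<lambda>(u, y). y = h u) z"

definition cost_assumption ::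
  "((real^'m) \<times> (real^'p) \<Rightarrow> real) \<Rightarrow> (real^'m \<Rightarrow> real^'p) \<Rightarrow> bool" where
  "cost_assumption \<Phi> h \<longleftrightarrow>
     continuously_differentiable \<Phi> \<and> locally_lipschitz (gradient \<Phi>) \<and> (\<exists>z. is_solution \<Phi> h z)"

definition reduced_cost ::
  "((real^'m) \<times> (real^'p) \<Rightarrow> real) \<Rightarrow> (real^'m \<Rightarrow> real^'p) \<Rightarrow> real^'m \<Rightarrow> real" where
  "reduced_cost \<Phi> h u = \<Phi> (u, h u)"

text \<open>The block matrix \<open>[I, (\<nabla>h u)\<^sup>T]\<close> as an operator on pairs.\<close>

definition Htilde ::
  "(real^'m \<Rightarrow> real^'p) \<Rightarrow> real^'m \<Rightarrow> (real^'m) \<times> (real^'p) \<Rightarrow> real^'m" where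
  "Htilde h u w = mat 1 *v fst w + transpose (jacobian h (at u)) *v snd w"

definition closed_loop ::
  "((real^'n) \<times> (real^'m) \<Rightarrow> real^'n) \<Rightarrow> (real^'n \<Rightarrow> real^'p) \<Rightarrow> (real^'m \<Rightarrow> real^'p) \<Rightarrow>
   ((real^'m) \<times> (real^'p) \<Rightarrow> real) \<Rightarrow> real \<Rightarrow> (real^'n) \<times> (real^'m) \<Rightarrow> (real^'n) \<times> (real^'m)" where
  "closed_loop f g h \<Phi> \<alpha> =
     (\<lambda>(x, u). (f (x, u), - \<alpha> *\<^sub>R Htilde h u (gradient \<Phi> (u, g x))))"

end

theory Submission
  imports Defs
begin

text \<open>The two dissipation inequalities describe a feedback interconnection of plant and
  controller, and condition (iii) is a small-gain condition: eliminating \<open>\<xi>\<close> from it leaves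
  \<open>\<theta>1 \<theta>2 < \<mu>1 \<mu>2\<close>. Hence there is a weight \<open>\<eta>\<close> with \<open>\<theta>1 / \<mu>2 < \<eta> < \<mu>1 / \<theta>2\<close>
  (\<open>small_gain_weight\<close>). Adding \<open>\<eta>\<close> times (ii) to (i) bounds the combined left-hand sides by
  \<open>- (\<mu>1 - \<eta> \<theta>2) Vx - (\<eta> \<mu>2 - \<theta>1) Vu\<close>, where both coefficients of the Lyapunov functions are
  negative: the damping terms dominate the cross terms. This single inequality is used twice.

  Dynamically: since the controller moves with speed \<open>\<alpha>\<close>, the combined left-hand sides
  are the derivative of \<open>V = Vx + (\<eta> / \<alpha>) Vu\<close> along the closed loop. So \<open>V\<close> decays exponentially,
  and since it lies between two multiples of the squared distance to the equilibrium, so does that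
  distance. The speed \<open>\<alpha>\<close> enters only through the weight of \<open>Vu\<close>, so that every \<open>\<alpha> > 0\<close> works.

  Statically: a minimizer of the constrained problem has the form \<open>(u, h u)\<close> with \<open>u\<close> critical for
  the reduced cost. At \<open>(s u, u)\<close> the plant is at rest and the controller field vanishes, so the
  left-hand sides of (i) and (ii) are zero and the combination forces \<open>Vu u = 0\<close>, that is
  \<open>u = ustar\<close>. As a minimizer exists, it is \<open>(ustar, h ustar)\<close>.

  What remains is the existence of solutions for all times
  (\<open>globally_exponentially_stable_if_lyapunov\<close>). The closed loop is only locally
  Lipschitz. Precomposing it with the nearest-point projection onto a large ball makes it globally
  Lipschitz without changing it on the ball; the modified equation has a global solution by
  Picard's contraction argument, and the Lyapunov function keeps this solution inside the ball, so
  it solves the original equation.\<close>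

section \<open>Global solutions for globally Lipschitz vector fields\<close>

text \<open>The integral inherits the growth rate \<open>exp (k t)\<close> of its integrand but gains a factor \<open>1 / k\<close>.
  This gain is what makes Picard's operator a contraction in the weighted norm used next.\<close>

lemma exp_weighted_integral_bound:
  fixes H :: "real \<Rightarrow> 'a::banach"
  assumes t: "0 \<le> t" and k: "0 < k" and cont: "continuous_on {0..t} H"
    and bound: "\<And>s. s \<in> {0..t} \<Longrightarrow> norm (H s) \<le> B * exp (k * s)"
  shows "exp (- (k * t)) * norm (integral {0..t} H) \<le> B / k"
proof -
  have B: "0 \<le> B" using bound[of 0] t order_trans[OF norm_ge_zero] by simp
  have "((\<lambda>s. B * exp (k * s)) has_integral B / k * exp (k * t) - B / k * exp (k * 0)) {0..t}"
    using k by (intro fundamental_theorem_of_calculus t)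
      (auto intro!: derivative_eq_intros simp: has_real_derivative_iff_has_vector_derivative[symmetric])
  then have int: "((\<lambda>s. B * exp (k * s)) has_integral B / k * (exp (k * t) - 1)) {0..t}"
    by (simp add: algebra_simps)
  have "norm (integral {0..t} H) \<le> integral {0..t} (\<lambda>s. B * exp (k * s))"
    using int bound by (intro integral_norm_bound_integral integrable_continuous_real cont continuous_intros) auto
  also have "\<dots> = B / k * (exp (k * t) - 1)" using int by (rule integral_unique)
  also have "\<dots> \<le> B / k * exp (k * t)" using B k by (intro mult_left_mono) auto
  finally have "exp (- (k * t)) * norm (integral {0..t} H) \<le> exp (- (k * t)) * (B / k * exp (k * t))"
    by (rule mult_left_mono) simp
  also have "\<dots> = B / k" by (simp add: exp_minus field_simps)
  finally show ?thesis .
qed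

text \<open>Picard's theorem in one step on the whole half-line, without gluing local solutions: a solution
  grows at most like \<open>exp (k t)\<close> when \<open>k\<close> exceeds the Lipschitz constant, so the unknown is the
  bounded function \<open>w t = exp (- k t) z t\<close>. On bounded continuous functions with the
  supremum norm, which is Bielecki's weighted norm of \<open>z\<close>, the integral operator contracts
  with factor \<open>L / k\<close>.\<close>

lemma global_solution_if_lipschitz:
  fixes G :: "'a::banach \<Rightarrow> 'a"
  assumes lip: "L-lipschitz_on UNIV G"
  shows "\<exists>z. solution_on G {0..} z \<and> z 0 = x0"
proof -
  have L: "0 \<le> L" using lip by (rule lipschitz_on_nonneg)
  \<comment> \<open>Any \<open>k > L\<close> would do.\<close>
  define k where "k = 2 * L + 1"
  have k: "0 < k" using L by (simp add: k_def)
  define H where "H = (\<lambda>(w :: real \<Rightarrow>\<^sub>C 'a) s. G (exp (k * s) *\<^sub>R w s))"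
  \<comment> \<open>Time is cut off at \<open>0\<close> because bounded continuous functions live on the whole real line.\<close>
  define P where "P = (\<lambda>w t. exp (- (k * max 0 t)) *\<^sub>R (x0 + integral {0..max 0 t} (H w)))"
  have G_cont: "continuous_on S G" for S
    using lipschitz_on_continuous_on[OF lip] continuous_on_subset by blast
  have H_cont: "continuous_on S (H w)" for S w
    unfolding H_def by (rule continuous_on_compose2[OF G_cont[of UNIV]]) (auto intro!: continuous_intros)
  have int_deriv: "((\<lambda>t. integral {0..t} (H w)) has_vector_derivative H w t) (at t within {0..})"
    if "0 \<le> t" for w t
  proof -
    have "((\<lambda>u. integral {0..u} (H w)) has_vector_derivative H w t) (at t within {0..t+1})"
      using that by (intro integral_has_vector_derivative H_cont) auto
    moreover have "at t within {0..} = at t within {0..t+1}"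
      by (rule at_within_nhd[where S="{..<t+1}"]) auto
    ultimately show ?thesis by simp
  qed
  have P_bcontfun: "P w \<in> bcontfun" for w
  proof (rule bcontfun_normI)
    have int_cont: "continuous_on {0..} (\<lambda>t. integral {0..t} (H w))"
      using has_vector_derivative_continuous[OF int_deriv]
      by (simp add: continuous_on_eq_continuous_within)
    have "continuous_on UNIV (\<lambda>t. integral {0..max 0 t} (H w))"
      by (rule continuous_on_compose2[OF int_cont]) (auto intro!: continuous_intros)
    then show "continuous_on UNIV (P w)" unfolding P_def by (auto intro!: continuous_intros)
    fix t :: real
    have bd: "norm (H w s) \<le> (norm (G 0) + L * norm w) * exp (k * s)" if "s \<in> {0..max 0 t}" for s
    proof -
      have "norm (H w s) \<le> norm (G 0) + dist (H w s) (G 0)"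
        by (metis dist_norm norm_triangle_sub)
      also have "dist (H w s) (G 0) \<le> L * dist (exp (k * s) *\<^sub>R w s) 0"
        unfolding H_def using lip by (rule lipschitz_onD) auto
      also have "\<dots> = L * norm (w s) * exp (k * s)" by simp
      also have "\<dots> \<le> L * norm w * exp (k * s)"
        using L by (intro mult_right_mono mult_left_mono norm_bounded) auto
      also have "norm (G 0) \<le> norm (G 0) * exp (k * s)"
        using that k by (cases "0 \<le> t") (auto simp: mult_le_cancel_left1)
      finally show ?thesis by (simp add: algebra_simps)
    qed
    have "norm (P w t) \<le> exp (- (k * max 0 t)) * norm x0 + exp (- (k * max 0 t)) * norm (integral {0..max 0 t} (H w))"
      unfolding P_def by (simp add: distrib_left[symmetric] norm_triangle_ineq)
    also have "exp (- (k * max 0 t)) * norm x0 \<le> norm x0"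
      using k by (intro mult_left_le_one_le) auto
    also have "exp (- (k * max 0 t)) * norm (integral {0..max 0 t} (H w)) \<le> (norm (G 0) + L * norm w) / k"
      using bd by (intro exp_weighted_integral_bound k H_cont) auto
    finally show "norm (P w t) \<le> norm x0 + (norm (G 0) + L * norm w) / k" by simp
  qed
  define Q where "Q = (\<lambda>w. Bcontfun (P w))"
  have Q: "apply_bcontfun (Q w) = P w" for w
    unfolding Q_def using P_bcontfun by (rule Bcontfun_inverse)
  have "\<exists>!w. Q w = w"
  proof (rule banach_fix_type)
    show "0 \<le> L / k" "L / k < 1" using L by (auto simp: k_def)
    show "\<forall>w v. dist (Q w) (Q v) \<le> L / k * dist w v"
    proof (intro allI dist_bound)
      fix w v :: "real \<Rightarrow>\<^sub>C 'a" and t :: real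
      have bd: "norm (H w s - H v s) \<le> (L * dist w v) * exp (k * s)" for s
      proof -
        have "norm (H w s - H v s) \<le> L * dist (exp (k * s) *\<^sub>R w s) (exp (k * s) *\<^sub>R v s)"
          unfolding H_def dist_norm[symmetric] using lip by (rule lipschitz_onD) auto
        also have "\<dots> = L * dist (w s) (v s) * exp (k * s)"
          by (simp add: dist_norm scaleR_diff_right[symmetric])
        also have "\<dots> \<le> L * dist w v * exp (k * s)"
          using L by (intro mult_right_mono mult_left_mono dist_bounded) auto
        finally show ?thesis .
      qed
      have "integral {0..max 0 t} (\<lambda>s. H w s - H v s) = integral {0..max 0 t} (H w) - integral {0..max 0 t} (H v)"
        by (intro integral_diff integrable_continuous_real H_cont)
      then have "dist (Q w t) (Q v t) = exp (- (k * max 0 t)) * norm (integral {0..max 0 t} (\<lambda>s. H w s - H v s))"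
        by (simp add: Q P_def dist_norm scaleR_diff_right[symmetric])
      also have "\<dots> \<le> L * dist w v / k"
        using bd by (intro exp_weighted_integral_bound k continuous_on_diff H_cont) auto
      finally show "dist (Q w t) (Q v t) \<le> L / k * dist w v" by simp
    qed
  qed
  then obtain w where w: "Q w = w" by blast
  define z where "z = (\<lambda>t. x0 + integral {0..t} (H w))"
  have H_eq: "H w t = G (z t)" if "0 \<le> t" for t
  proof -
    have "w t = exp (- (k * t)) *\<^sub>R z t" using Q[of w] w that by (simp add: P_def z_def)
    then have "exp (k * t) *\<^sub>R w t = z t" by (simp add: exp_add[symmetric])
    then show ?thesis by (simp add: H_def)
  qed
  have "(z has_vector_derivative G (z t)) (at t within {0..})" if "0 \<le> t" for t
    unfolding z_def[abs_def] H_eq[OF that, unfolded z_def, symmetric]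
    using int_deriv[OF that, of w] by (auto intro!: derivative_eq_intros)
  then have "solution_on G {0..} z" by (simp add: solution_on_def)
  moreover have "z 0 = x0" by (simp add: z_def)
  ultimately show ?thesis by blast
qed

section \<open>Comparison, Lyapunov decay and uniqueness\<close>

text \<open>Gronwall's inequality in differential form: \<open>exp (\<sigma> t) v t\<close> has nonpositive derivative. The rate
  \<open>\<sigma>\<close> may be negative, and uniqueness of solutions rests on that case.\<close>

lemma exp_decay_if_deriv_bound:
  fixes v :: "real \<Rightarrow> real"
  assumes T: "0 \<le> T" and cont: "continuous_on {0..T} v"
    and deriv: "\<And>t. 0 < t \<Longrightarrow> t < T \<Longrightarrow> \<exists>D. (v has_real_derivative D) (at t) \<and> D \<le> - \<sigma> * v t"
  shows "v T \<le> exp (- \<sigma> * T) * v 0"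
proof -
  have "exp (\<sigma> * T) * v T \<le> exp (\<sigma> * 0) * v 0"
  proof (rule DERIV_nonpos_imp_decreasing_open[OF T])
    show "continuous_on {0..T} (\<lambda>t. exp (\<sigma> * t) * v t)" by (intro continuous_intros cont)
    fix t assume "0 < t" "t < T"
    then obtain D where D: "(v has_real_derivative D) (at t)" "D \<le> - \<sigma> * v t" using deriv by blast
    have "((\<lambda>t. exp (\<sigma> * t) * v t) has_real_derivative exp (\<sigma> * t) * (\<sigma> * v t + D)) (at t)"
      using D(1) by (auto intro!: derivative_eq_intros simp: algebra_simps)
    moreover have "exp (\<sigma> * t) * (\<sigma> * v t + D) \<le> 0" using D(2) by (simp add: mult_le_0_iff)
    ultimately show "\<exists>y. ((\<lambda>t. exp (\<sigma> * t) * v t) has_real_derivative y) (at t) \<and> y \<le> 0" by blast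
  qed
  then show ?thesis by (simp add: exp_minus field_simps)
qed

lemma solution_on_subset: "solution_on F I z \<Longrightarrow> J \<subseteq> I \<Longrightarrow> solution_on F J z"
  unfolding solution_on_def by (meson has_vector_derivative_within_subset subset_iff)

lemma solution_on_continuous: "solution_on F I z \<Longrightarrow> continuous_on I z"
  unfolding solution_on_def by (meson continuous_on_eq_continuous_within has_vector_derivative_continuous)

lemma solution_on_interior:
  assumes "solution_on F {0..T} z" "0 < t" "t < T"
  shows "(z has_vector_derivative F (z t)) (at t)"
  using assms at_within_Icc_at[of 0 t T] unfolding solution_on_def by (metis atLeastAtMost_iff less_imp_le)

text \<open>The decrease condition is only asked along the trajectory, so that the lemma also applies to
  a vector field that agrees with the one of interest merely where the trajectory happens to be.\<close>

lemma lyapunov_decay: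
  fixes F :: "'a::real_inner \<Rightarrow> 'a"
  assumes sol: "solution_on F {0..T} z" and T: "0 \<le> T"
    and grad: "\<And>x. GDERIV V x :> D x"
    and decr: "\<And>t. 0 < t \<Longrightarrow> t < T \<Longrightarrow> D (z t) \<bullet> F (z t) \<le> - \<sigma> * V (z t)"
  shows "V (z T) \<le> exp (- \<sigma> * T) * V (z 0)"
proof (rule exp_decay_if_deriv_bound[where v="\<lambda>t. V (z t)", OF T])
  have "continuous_on UNIV V"
    using grad by (meson continuous_at_imp_continuous_on gderiv_def has_derivative_continuous)
  then show "continuous_on {0..T} (\<lambda>t. V (z t))"
    by (rule continuous_on_compose2) (auto intro: solution_on_continuous[OF sol])
  fix t assume t: "0 < t" "t < T"
  have "((\<lambda>t. V (z t)) has_derivative (\<lambda>h. (h *\<^sub>R F (z t)) \<bullet> D (z t))) (at t)"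
    using has_derivative_compose[OF solution_on_interior[OF sol t, unfolded has_vector_derivative_def]]
      grad[of "z t"] unfolding gderiv_def by blast
  moreover have "(\<lambda>h. (h *\<^sub>R F (z t)) \<bullet> D (z t)) = (*) (D (z t) \<bullet> F (z t))"
    by (auto simp: inner_commute)
  ultimately have "((\<lambda>t. V (z t)) has_real_derivative D (z t) \<bullet> F (z t)) (at t)"
    unfolding has_field_derivative_def by simp
  then show "\<exists>y. ((\<lambda>t. V (z t)) has_real_derivative y) (at t) \<and> y \<le> - \<sigma> * V (z t)"
    using decr[OF t] by blast
qed

text \<open>\<open>local_lipschitz\<close> concerns families of functions indexed by a parameter; a singleton
  parameter set gives access to its compactness theorem.\<close>

lemma locally_lipschitz_iff_local_lipschitz:
  "locally_lipschitz f \<longleftrightarrow> local_lipschitz {0::real} UNIV (\<lambda>_. f)"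
  unfolding locally_lipschitz_def local_lipschitz_def by (auto; force)

lemma locally_lipschitz_imp_continuous:
  "locally_lipschitz f \<Longrightarrow> continuous_on S f"
  unfolding locally_lipschitz_iff_local_lipschitz
  by (rule local_lipschitz_continuous_on[OF local_lipschitz_subset, of _ _ _ "{0}" S 0]) auto

lemma locally_lipschitz_on_compact:
  assumes "locally_lipschitz f" "compact K"
  obtains L where "L-lipschitz_on K f"
proof -
  have "local_lipschitz {0::real} K (\<lambda>_. f)"
    using assms(1) unfolding locally_lipschitz_iff_local_lipschitz by (rule local_lipschitz_subset) auto
  from local_lipschitz_compact_implies_lipschitz[OF this assms(2)] that show ?thesis by auto
qed

text \<open>Both trajectories stay in a compact set, on which the field has a Lipschitz constant \<open>L\<close>; their
  squared distance then grows at most like \<open>exp (2 L t)\<close> from the value \<open>0\<close>.\<close>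

lemma solution_unique:
  fixes F :: "'a::real_inner \<Rightarrow> 'a"
  assumes F: "locally_lipschitz F" and T: "0 \<le> T"
    and x: "solution_on F {0..T} x" and z: "solution_on F {0..T} z" and init: "x 0 = z 0"
  shows "x T = z T"
proof -
  have cont: "continuous_on {0..T} x" "continuous_on {0..T} z"
    using x z by (auto intro: solution_on_continuous)
  have "compact (x ` {0..T} \<union> z ` {0..T})"
    by (intro compact_Un compact_continuous_image cont) auto
  then obtain L where L: "L-lipschitz_on (x ` {0..T} \<union> z ` {0..T}) F"
    using locally_lipschitz_on_compact[OF F] by blast
  have "(x T - z T) \<bullet> (x T - z T) \<le> exp (- (- (2 * L)) * T) * ((x 0 - z 0) \<bullet> (x 0 - z 0))"
  proof (rule exp_decay_if_deriv_bound[where v="\<lambda>t. (x t - z t) \<bullet> (x t - z t)", OF T])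
    show "continuous_on {0..T} (\<lambda>t. (x t - z t) \<bullet> (x t - z t))" by (intro continuous_intros cont)
    fix t assume t: "0 < t" "t < T"
    let ?D = "2 * ((x t - z t) \<bullet> (F (x t) - F (z t)))"
    have "((\<lambda>t. x t - z t) has_derivative (\<lambda>h. h *\<^sub>R (F (x t) - F (z t)))) (at t)"
      using has_vector_derivative_diff[OF solution_on_interior[OF x t] solution_on_interior[OF z t]]
      unfolding has_vector_derivative_def .
    from has_derivative_inner[OF this this]
    have "((\<lambda>t. (x t - z t) \<bullet> (x t - z t)) has_real_derivative ?D) (at t)"
      unfolding has_field_derivative_def by (rule has_derivative_eq_rhs) (auto simp: inner_commute)
    moreover have "?D \<le> 2 * L * ((x t - z t) \<bullet> (x t - z t))"
    proof -
      have "(x t - z t) \<bullet> (F (x t) - F (z t)) \<le> norm (x t - z t) * dist (F (x t)) (F (z t))"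
        by (simp add: dist_norm norm_cauchy_schwarz)
      also have "\<dots> \<le> norm (x t - z t) * (L * dist (x t) (z t))"
        using t by (intro mult_left_mono lipschitz_onD[OF L]) auto
      also have "\<dots> = L * ((x t - z t) \<bullet> (x t - z t))"
        by (simp add: dist_norm dot_square_norm power2_eq_square)
      finally show ?thesis by simp
    qed
    ultimately show "\<exists>D. ((\<lambda>t. (x t - z t) \<bullet> (x t - z t)) has_real_derivative D) (at t) \<and>
        D \<le> - (- (2 * L)) * ((x t - z t) \<bullet> (x t - z t))" by auto
  qed
  then have "(x T - z T) \<bullet> (x T - z T) = 0" using init inner_ge_zero[of "x T - z T"] by simp
  then show ?thesis by simp
qed

section \<open>Global solutions and exponential stability from a Lyapunov function\<close>

lemma first_exit_time:
  fixes n :: "real \<Rightarrow> real"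
  assumes "continuous_on {0..T} n" "n 0 < R" "R \<le> n T" "0 \<le> T"
  obtains t where "0 \<le> t" "t \<le> T" "n t = R" "\<And>s. 0 \<le> s \<Longrightarrow> s < t \<Longrightarrow> n s < R"
proof -
  define A where "A = {t \<in> {0..T}. n t = R}"
  have "closed A" unfolding A_def by (intro continuous_closed_preimage_constant assms) auto
  moreover have "A \<noteq> {}" using IVT'[of n 0 R T] assms unfolding A_def by auto
  moreover have bb: "bdd_below A" unfolding A_def by auto
  ultimately have Inf: "Inf A \<in> A" by (intro closed_contains_Inf)
  show thesis
  proof
    show "0 \<le> Inf A" "Inf A \<le> T" "n (Inf A) = R" using Inf unfolding A_def by auto
    fix s assume s: "0 \<le> s" "s < Inf A"
    show "n s < R"
    proof (rule ccontr)
      assume "\<not> n s < R"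
      then obtain r where "0 \<le> r" "r \<le> s" "n r = R"
        using IVT'[of n 0 R s] assms s \<open>Inf A \<le> T\<close> continuous_on_subset[OF assms(1), of "{0..s}"] by auto
      then have "r \<in> A" using s \<open>Inf A \<le> T\<close> by (auto simp: A_def)
      then show False using cInf_lower[OF _ bb, of r] s \<open>r \<le> s\<close> by auto
    qed
  qed
qed

text \<open>The cut-off argument: the sublevel set of \<open>V\<close> through the initial point lies strictly inside a
  ball. Up to the first time at which the solution of the truncated equation reaches the boundary of
  the ball it solves the original equation, so \<open>V\<close> has not increased, and the solution is
  still in the sublevel set, hence not at the boundary.\<close>

lemma global_solution_if_lyapunov:
  fixes F :: "'a::euclidean_space \<Rightarrow> 'a"
  assumes F: "locally_lipschitz F"
    and grad: "\<And>x. GDERIV V x :> D x"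
    and decr: "\<And>x. D x \<bullet> F x \<le> - \<sigma> * V x"
    and \<sigma>: "0 \<le> \<sigma>" and c: "0 < c"
    and lower: "\<And>x. c * (norm (x - e))\<^sup>2 \<le> V x"
  shows "\<exists>z. solution_on F {0..} z \<and> z 0 = x0"
proof -
  have V_nonneg: "0 \<le> V x" for x
    using c lower[of x] by (meson less_imp_le mult_nonneg_nonneg order_trans zero_le_power2)
  \<comment> \<open>The square root bounds the radius of the sublevel set; the summand \<open>1\<close> makes the inclusion strict.\<close>
  define R where "R = sqrt (V x0 / c) + 1"
  have R: "0 < R" using V_nonneg[of x0] c by (simp add: R_def add_nonneg_pos)
  have inside: "norm (x - e) < R" if "V x \<le> V x0" for x
  proof -
    have "(norm (x - e))\<^sup>2 \<le> V x0 / c" using lower[of x] that c by (simp add: field_simps)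
    then have "norm (x - e) \<le> sqrt (V x0 / c)" using real_le_rsqrt by blast
    then show ?thesis by (simp add: R_def)
  qed
  define p where "p = closest_point (cball e R)"
  have p_in: "p x \<in> cball e R" for x
    unfolding p_def using R by (intro closest_point_in_set) auto
  have p_id: "p x = x" if "x \<in> cball e R" for x
    using that unfolding p_def by (simp add: closest_point_self)
  have p_lip: "dist (p x) (p y) \<le> dist x y" for x y
    unfolding p_def using R by (intro closest_point_lipschitz) auto
  obtain L where L: "L-lipschitz_on (cball e R) F"
    using locally_lipschitz_on_compact[OF F compact_cball] by blast
  have "L-lipschitz_on UNIV (\<lambda>x. F (p x))"
  proof (rule lipschitz_onI)
    show L0: "0 \<le> L" using L by (rule lipschitz_on_nonneg)
    fix x y
    have "dist (F (p x)) (F (p y)) \<le> L * dist (p x) (p y)"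
      using L p_in p_in by (rule lipschitz_onD)
    also have "\<dots> \<le> L * dist x y" using L0 p_lip by (intro mult_left_mono)
    finally show "dist (F (p x)) (F (p y)) \<le> L * dist x y" .
  qed
  then obtain z where z: "solution_on (\<lambda>x. F (p x)) {0..} z" and z0: "z 0 = x0"
    using global_solution_if_lipschitz by blast
  have stay: "norm (z T - e) < R" if T: "0 \<le> T" for T
  proof (rule ccontr)
    assume "\<not> norm (z T - e) < R"
    moreover have "continuous_on {0..T} (\<lambda>t. norm (z t - e))"
      using solution_on_continuous[OF solution_on_subset[OF z]] by (intro continuous_intros) auto
    moreover have "norm (z 0 - e) < R" using inside z0 by simp
    ultimately obtain t where t: "0 \<le> t" "norm (z t - e) = R"
      and before: "\<And>s. 0 \<le> s \<Longrightarrow> s < t \<Longrightarrow> norm (z s - e) < R"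
      using T first_exit_time[of T "\<lambda>t. norm (z t - e)" R] by (metis not_less)
    have "V (z t) \<le> exp (- \<sigma> * t) * V (z 0)"
    proof (rule lyapunov_decay[OF solution_on_subset[OF z] t(1) grad])
      fix s assume "0 < s" "s < t"
      then have "p (z s) = z s" using before[of s] by (intro p_id) (simp add: dist_norm norm_minus_commute)
      then show "D (z s) \<bullet> F (p (z s)) \<le> - \<sigma> * V (z s)" using decr by simp
    qed auto
    also have "\<dots> \<le> V x0" using \<sigma> t(1) V_nonneg[of x0] by (simp add: z0 mult_left_le_one_le)
    finally show False using inside t(2) by force
  qed
  have "p (z t) = z t" if "0 \<le> t" for t
    using stay[OF that] by (intro p_id) (simp add: dist_norm norm_minus_commute)
  then have "solution_on F {0..} z" using z unfolding solution_on_def by simp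
  then show ?thesis using z0 by blast
qed

text \<open>The direct method. Since \<open>V\<close> is comparable to the square of the distance, the distance itself
  decays at half the rate of \<open>V\<close>.\<close>

theorem globally_exponentially_stable_if_lyapunov:
  fixes F :: "'a::euclidean_space \<Rightarrow> 'a"
  assumes F: "locally_lipschitz F" and eq: "F e = 0"
    and grad: "\<And>x. GDERIV V x :> D x"
    and decr: "\<And>x. D x \<bullet> F x \<le> - \<sigma> * V x"
    and pos: "0 < \<sigma>" "0 < c" "0 < d"
    and lower: "\<And>x. c * (norm (x - e))\<^sup>2 \<le> V x"
    and upper: "\<And>x. V x \<le> d * (norm (x - e))\<^sup>2"
  shows "globally_exponentially_stable F e"
  unfolding globally_exponentially_stable_def
proof (intro conjI allI)
  show "F e = 0" by (fact eq)
  fix x0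
  obtain x where x: "solution_on F {0..} x" "x 0 = x0"
    using global_solution_if_lyapunov[OF F grad decr _ pos(2) lower] pos by auto
  have "z t = x t" if I: "is_interval I" "0 \<in> I" "I \<subseteq> {0..}" "solution_on F I z" "z 0 = x0" "t \<in> I" for I z t
  proof -
    have sub: "{0..t} \<subseteq> I"
      using mem_is_interval_1_I[OF I(1,2,6)] by (meson atLeastAtMost_iff subsetI)
    have t: "0 \<le> t" using I(3,6) by auto
    have "solution_on F {0..t} z" "solution_on F {0..t} x"
      using solution_on_subset[OF I(4) sub] solution_on_subset[OF x(1)] by auto
    then show ?thesis using solution_unique[OF F t] I(5) x(2) by metis
  qed
  then show "unique_global_solution F x0" unfolding unique_global_solution_def using x by blast
next
  have "norm (x t - e) \<le> sqrt (d / c) * exp (- (\<sigma> / 2) * t) * norm (x 0 - e)"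
    if x: "solution_on F {0..} x" and t: "0 \<le> t" for x t
  proof (rule power2_le_imp_le)
    have "c * (norm (x t - e))\<^sup>2 \<le> V (x t)" by (rule lower)
    also have "\<dots> \<le> exp (- \<sigma> * t) * V (x 0)"
      using decr by (intro lyapunov_decay[OF solution_on_subset[OF x] t grad]) auto
    also have "\<dots> \<le> exp (- \<sigma> * t) * (d * (norm (x 0 - e))\<^sup>2)" by (intro mult_left_mono upper) simp
    finally have "(norm (x t - e))\<^sup>2 \<le> d / c * exp (- \<sigma> * t) * (norm (x 0 - e))\<^sup>2"
      using pos by (simp add: field_simps)
    also have "exp (- \<sigma> * t) = (exp (- (\<sigma> / 2) * t))\<^sup>2"
      by (simp add: power2_eq_square exp_add[symmetric])
    finally show "(norm (x t - e))\<^sup>2 \<le> (sqrt (d / c) * exp (- (\<sigma> / 2) * t) * norm (x 0 - e))\<^sup>2"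
      using pos by (simp add: power_mult_distrib)
    show "0 \<le> sqrt (d / c) * exp (- (\<sigma> / 2) * t) * norm (x 0 - e)" using pos by simp
  qed
  moreover have "0 < sqrt (d / c)" "0 < \<sigma> / 2" using pos by auto
  ultimately show "\<exists>K>0. \<exists>\<sigma>>0. \<forall>x. solution_on F {0..} x
      \<longrightarrow> (\<forall>t\<ge>0. norm (x t - e) \<le> K * exp (- \<sigma> * t) * norm (x 0 - e))" by blast
qed

lemma globally_exponentially_stable_tendsto:
  assumes "globally_exponentially_stable F e" and "solution_on F {0..} x"
  shows "(x \<longlongrightarrow> e) at_top"
proof -
  obtain K \<sigma> where "0 < \<sigma>" and
    bound: "\<And>t. 0 \<le> t \<Longrightarrow> norm (x t - e) \<le> K * exp (- \<sigma> * t) * norm (x 0 - e)"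
    using assms unfolding globally_exponentially_stable_def by blast
  have "((\<lambda>t. exp (- \<sigma> * t)) \<longlongrightarrow> 0) at_top"
    using \<open>0 < \<sigma>\<close> by (intro filterlim_compose[OF exp_at_bot] filterlim_tendsto_neg_mult_at_bot[OF tendsto_const])
      (auto intro: filterlim_ident)
  then have "((\<lambda>t. K * exp (- \<sigma> * t) * norm (x 0 - e)) \<longlongrightarrow> K * 0 * norm (x 0 - e)) at_top"
    by (intro tendsto_intros)
  moreover have "eventually (\<lambda>t. norm (x t - e) \<le> K * exp (- \<sigma> * t) * norm (x 0 - e)) at_top"
    using eventually_ge_at_top[of 0] by eventually_elim (rule bound)
  ultimately have "((\<lambda>t. x t - e) \<longlongrightarrow> 0) at_top"
    by (auto intro: Lim_null_comparison)
  then show ?thesis by (simp add: Lim_null[symmetric])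
qed

section \<open>Local Lipschitz continuity of the closed loop\<close>

lemma locally_lipschitz_compose:
  assumes f: "locally_lipschitz f" and g: "locally_lipschitz g"
  shows "locally_lipschitz (\<lambda>x. f (g x))"
  unfolding locally_lipschitz_def
proof
  fix x
  obtain e L where e: "0 < e" and L: "L-lipschitz_on (cball (g x) e) f"
    using f unfolding locally_lipschitz_def by blast
  obtain d M where d: "0 < d" and M: "M-lipschitz_on (cball x d) g"
    using g unfolding locally_lipschitz_def by blast
  have M0: "0 \<le> M" using M by (rule lipschitz_on_nonneg)
  define r where "r = min d (e / (M + 1))"
  have r: "0 < r" "r \<le> d" using d e M0 by (auto simp: r_def)
  have "M * r \<le> e"
  proof -
    have "M * r \<le> M * (e / (M + 1))" using M0 by (intro mult_left_mono) (auto simp: r_def)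
    also have "\<dots> \<le> e" using M0 e by (simp add: field_simps)
    finally show ?thesis .
  qed
  have M': "M-lipschitz_on (cball x r) g" using r(2) by (intro lipschitz_on_subset[OF M]) auto
  have "g ` cball x r \<subseteq> cball (g x) e"
  proof (clarsimp)
    fix y assume y: "dist x y \<le> r"
    have "dist (g x) (g y) \<le> M * dist x y" using lipschitz_onD[OF M', of x y] y r by auto
    also have "\<dots> \<le> M * r" using y M0 by (intro mult_left_mono)
    finally show "dist (g x) (g y) \<le> e" using \<open>M * r \<le> e\<close> by simp
  qed
  then have "(L * M)-lipschitz_on (cball x r) (\<lambda>y. f (g y))"
    by (intro lipschitz_on_compose2 M' lipschitz_on_subset[OF L])
  then show "\<exists>e>0. \<exists>L. L-lipschitz_on (cball x e) (\<lambda>x. f (g x))" using r(1) by blast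
qed

lemma locally_lipschitz_Pair:
  "locally_lipschitz f \<Longrightarrow> locally_lipschitz g \<Longrightarrow> locally_lipschitz (\<lambda>x. (f x, g x))"
  unfolding locally_lipschitz_iff_local_lipschitz by (rule local_lipschitz_PairI)

lemma locally_lipschitz_bounded_linear: "bounded_linear f \<Longrightarrow> locally_lipschitz f"
  unfolding locally_lipschitz_iff_local_lipschitz by (rule bounded_linear.local_lipschitzI)

text \<open>Products of locally Lipschitz functions reduce to this case by composition. The proof splits
  \<open>m a b - m a' b'\<close> into \<open>m (a - a') b + m a' (b - b')\<close> on a unit ball, where both
  arguments are bounded.\<close>

lemma locally_lipschitz_bounded_bilinear:
  fixes m :: "'a::real_normed_vector \<Rightarrow> 'b::real_normed_vector \<Rightarrow> 'c::real_normed_vector"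
  assumes "bounded_bilinear m"
  shows "locally_lipschitz (\<lambda>(a, b). m a b)"
  unfolding locally_lipschitz_def
proof
  interpret bounded_bilinear m by (fact assms)
  fix x :: "'a \<times> 'b"
  obtain K where K: "0 \<le> K" "\<And>a b. norm (m a b) \<le> norm a * norm b * K"
    using nonneg_bounded by blast
  define B where "B = norm x + 1"
  have B: "norm (fst y) \<le> B" "norm (snd y) \<le> B" if "y \<in> cball x 1" for y
  proof -
    have "norm y \<le> norm x + 1"
      using that norm_triangle_sub[of y x] by (simp add: dist_norm norm_minus_commute)
    then show "norm (fst y) \<le> B" "norm (snd y) \<le> B"
      using norm_fst_le[of "fst y" "snd y"] norm_snd_le[of "snd y" "fst y"] by (auto simp: B_def)
  qed
  have "(2 * B * K)-lipschitz_on (cball x 1) (\<lambda>(a, b). m a b)"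
  proof (rule lipschitz_onI)
    show "0 \<le> 2 * B * K" using K by (simp add: B_def)
    have B0: "0 \<le> B" by (simp add: B_def)
    fix y z assume yz: "y \<in> cball x 1" "z \<in> cball x 1"
    have fs: "norm (fst y - fst z) \<le> dist y z" "norm (snd y - snd z) \<le> dist y z"
      by (simp_all add: dist_norm[symmetric] dist_fst_le dist_snd_le)
    have "m (fst y) (snd y) - m (fst z) (snd z)
        = m (fst y - fst z) (snd y) + m (fst z) (snd y - snd z)"
      by (simp add: diff_left diff_right)
    then have "dist (m (fst y) (snd y)) (m (fst z) (snd z))
        \<le> norm (m (fst y - fst z) (snd y)) + norm (m (fst z) (snd y - snd z))"
      by (simp add: dist_norm norm_triangle_ineq)
    also have "\<dots> \<le> dist y z * B * K + B * dist y z * K"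
      using K(1) fs B(2)[OF yz(1)] B(1)[OF yz(2)] B0
      by (intro add_mono order_trans[OF K(2)] mult_right_mono mult_mono) auto
    finally show "dist (case y of (a, b) \<Rightarrow> m a b) (case z of (a, b) \<Rightarrow> m a b) \<le> 2 * B * K * dist y z"
      by (simp add: case_prod_beta algebra_simps)
  qed
  then show "\<exists>e>0. \<exists>L. L-lipschitz_on (cball x e) (\<lambda>(a, b). m a b)" by (meson zero_less_one)
qed

lemma bounded_bilinear_transpose_mult:
  "bounded_bilinear (\<lambda>(A :: real^'m^'p) (y :: real^'p). transpose A *v y)"
  unfolding bilinear_conv_bounded_bilinear[symmetric] bilinear_def
  by (intro conjI allI linearI)
    (simp_all add: vec_eq_iff matrix_vector_mult_def transpose_def sum.distrib sum_distrib_left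
      distrib_left distrib_right mult.assoc mult.left_commute)

lemma Htilde_altdef: "Htilde h u w = fst w + transpose (jacobian h (at u)) *v snd w"
  by (simp add: Htilde_def)

lemma locally_lipschitz_closed_loop:
  fixes f :: "(real^'n) \<times> (real^'m) \<Rightarrow> real^'n" and g :: "real^'n \<Rightarrow> real^'p"
  assumes f: "locally_lipschitz f" and g: "locally_lipschitz g"
    and h: "locally_lipschitz (\<lambda>u. jacobian h (at u))" and \<Phi>: "locally_lipschitz (gradient \<Phi>)"
  shows "locally_lipschitz (closed_loop f g h \<Phi> \<alpha>)"
proof -
  let ?w = "\<lambda>z :: (real^'n) \<times> (real^'m). gradient \<Phi> (snd z, g (fst z))"
    and ?J = "\<lambda>z :: (real^'n) \<times> (real^'m). jacobian h (at (snd z))"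
  note fst = locally_lipschitz_bounded_linear[OF bounded_linear_fst]
    and snd = locally_lipschitz_bounded_linear[OF bounded_linear_snd]
  have w: "locally_lipschitz ?w"
    by (rule locally_lipschitz_compose[OF \<Phi> locally_lipschitz_Pair[OF snd locally_lipschitz_compose[OF g fst]]])
  have "locally_lipschitz (\<lambda>z. transpose (?J z) *v snd (?w z))"
    using locally_lipschitz_compose[OF locally_lipschitz_bounded_bilinear[OF bounded_bilinear_transpose_mult]
        locally_lipschitz_Pair[OF locally_lipschitz_compose[OF h snd] locally_lipschitz_compose[OF snd w]]]
    by simp
  moreover have "bounded_linear (\<lambda>v :: (real^'m) \<times> (real^'m). - \<alpha> *\<^sub>R (fst v + snd v))"
    by (intro bounded_linear_const_scaleR bounded_linear_add bounded_linear_fst bounded_linear_snd)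
  note combine = locally_lipschitz_bounded_linear[OF this]
  ultimately have "locally_lipschitz (\<lambda>z. - \<alpha> *\<^sub>R (fst (?w z) + transpose (?J z) *v snd (?w z)))"
    using locally_lipschitz_compose[OF combine locally_lipschitz_Pair[OF locally_lipschitz_compose[OF fst w]]]
    by simp
  with f show ?thesis
    unfolding closed_loop_def case_prod_beta Htilde_altdef by (intro locally_lipschitz_Pair) simp_all
qed

section \<open>Gradients and the reduced cost\<close>

lemma continuously_differentiable_imp_differentiable:
  "continuously_differentiable f \<Longrightarrow> f differentiable (at x)"
  unfolding continuously_differentiable_def differentiable_def by blast

text \<open>Riesz representation: the gradient is the adjoint of the derivative applied to \<open>1\<close>.\<close>

lemma GDERIV_gradient:
  fixes f :: "'a::euclidean_space \<Rightarrow> real"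
  assumes "f differentiable (at x)"
  shows "GDERIV f x :> gradient f x"
proof -
  obtain f' where f': "(f has_derivative f') (at x)" using assms unfolding differentiable_def by blast
  then have lin: "linear f'" by (intro bounded_linear.linear has_derivative_bounded_linear)
  have "f' = (\<lambda>v. v \<bullet> adjoint f' 1)"
    using adjoint_works[OF lin, of _ 1] by (simp add: fun_eq_iff)
  then have "GDERIV f x :> adjoint f' 1" using f' unfolding gderiv_def by (rule has_derivative_eq_rhs[rotated])
  then show ?thesis using gradient_eqI[of f x "adjoint f' 1"] by simp
qed

lemma GDERIV_if_continuously_differentiable:
  fixes f :: "'a::euclidean_space \<Rightarrow> real"
  shows "continuously_differentiable f \<Longrightarrow> GDERIV f x :> gradient f x"
  by (intro GDERIV_gradient continuously_differentiable_imp_differentiable)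

text \<open>The chain rule. It says that at a plant steady state the controller follows the negative
  gradient of the reduced cost, so it rests there exactly at the critical points.\<close>

lemma GDERIV_reduced_cost:
  fixes \<Phi> :: "(real^'m) \<times> (real^'p) \<Rightarrow> real"
  assumes \<Phi>: "\<Phi> differentiable (at (u, h u))" and h: "h differentiable (at u)"
  shows "GDERIV (reduced_cost \<Phi> h) u :> Htilde h u (gradient \<Phi> (u, h u))"
proof -
  let ?J = "jacobian h (at u)" and ?w = "gradient \<Phi> (u, h u)"
  have "(h has_derivative (\<lambda>v. ?J *v v)) (at u)" using h by (simp add: jacobian_works[symmetric])
  then have "((\<lambda>u. (u, h u)) has_derivative (\<lambda>v. (v, ?J *v v))) (at u)"
    by (intro has_derivative_Pair) auto
  from has_derivative_compose[OF this GDERIV_gradient[OF \<Phi>, unfolded gderiv_def]]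
  have "(reduced_cost \<Phi> h has_derivative (\<lambda>v. (v, ?J *v v) \<bullet> ?w)) (at u)"
    by (simp add: reduced_cost_def[abs_def])
  moreover have "(v, ?J *v v) \<bullet> ?w = v \<bullet> Htilde h u ?w" for v
    using dot_lmul_matrix[of v "transpose ?J" "snd ?w"]
    by (simp add: Htilde_altdef inner_prod_def inner_add_right)
  ultimately show ?thesis by (simp add: gderiv_def)
qed

lemma gradient_zero_at_min:
  assumes "GDERIV f x :> D" and "\<And>y. f x \<le> f y"
  shows "D = 0"
proof -
  have "(\<lambda>h. h \<bullet> D) = (\<lambda>v. 0)"
    using assms by (intro differential_zero_maxmin[of x UNIV f]) (auto simp: gderiv_def)
  then have "D \<bullet> D = 0" by meson
  then show ?thesis by simp
qed

lemma GDERIV_separable_sum: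
  assumes "GDERIV V x :> D" "GDERIV W u :> E"
  shows "GDERIV (\<lambda>(x, u). V x + c * W u) (x, u) :> (D, c *\<^sub>R E)"
proof -
  have "((\<lambda>z. V (fst z)) has_derivative (\<lambda>h. fst h \<bullet> D)) (at (x, u))"
    using assms(1) unfolding gderiv_def
    by (intro has_derivative_compose[OF has_derivative_fst[OF has_derivative_ident], of V]) simp
  moreover have "((\<lambda>z. W (snd z)) has_derivative (\<lambda>h. snd h \<bullet> E)) (at (x, u))"
    using assms(2) unfolding gderiv_def
    by (intro has_derivative_compose[OF has_derivative_snd[OF has_derivative_ident], of W]) simp
  ultimately have "((\<lambda>z. V (fst z) + c * W (snd z)) has_derivative (\<lambda>h. fst h \<bullet> D + c * (snd h \<bullet> E))) (at (x, u))"
    by (intro has_derivative_add has_derivative_mult_right)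
  then show ?thesis by (simp add: gderiv_def case_prod_beta' inner_prod_def)
qed

section \<open>Stability of the feedback interconnection\<close>

text \<open>Condition (iii) says that \<open>\<xi>\<close> separates \<open>\<theta>2 / \<mu>2\<close> from \<open>\<mu>1 / \<theta>1\<close>. The weight has to separate
  \<open>\<theta>1 / \<mu>2\<close> from \<open>\<mu>1 / \<theta>2\<close> instead, but either is possible exactly when \<open>\<theta>1 \<theta>2 < \<mu>1 \<mu>2\<close>.\<close>

lemma small_gain_weight:
  fixes \<mu>1 :: real
  assumes "0 < \<theta>1" "0 < \<mu>2" "0 < \<theta>2" "0 < \<xi>"
    and "- \<mu>1 + \<xi> * \<theta>1 < 0" "\<theta>2 - \<xi> * \<mu>2 < 0"
  obtains \<eta> where "0 < \<eta>" "\<eta> * \<theta>2 < \<mu>1" "\<theta>1 < \<eta> * \<mu>2"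
proof -
  have "\<theta>1 * \<theta>2 < \<theta>1 * (\<xi> * \<mu>2)" using assms by (intro mult_strict_left_mono) auto
  also have "\<dots> = (\<xi> * \<theta>1) * \<mu>2" by simp
  also have "\<dots> < \<mu>1 * \<mu>2" using assms by (intro mult_strict_right_mono) auto
  finally have "\<theta>1 / \<mu>2 < \<mu>1 / \<theta>2" using assms by (simp add: field_simps)
  then obtain \<eta> where "\<theta>1 / \<mu>2 < \<eta>" "\<eta> < \<mu>1 / \<theta>2" using dense by blast
  moreover from this have "0 < \<eta>" using assms by (meson divide_pos_pos less_trans)
  ultimately show thesis using assms by (intro that[of \<eta>]) (auto simp: field_simps)
qed

theorem theorem1:
  fixes f :: "(real^'n) \<times> (real^'m) \<Rightarrow> real^'n"
    and g :: "real^'n \<Rightarrow> real^'p"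
    and s :: "real^'m \<Rightarrow> real^'n"
    and h :: "real^'m \<Rightarrow> real^'p"
    and \<Phi> :: "(real^'m) \<times> (real^'p) \<Rightarrow> real"
    and ustar :: "real^'m" and xstar :: "real^'n"
    and c1 d1 \<mu>1 \<theta>1 c2 d2 \<mu>2 \<theta>2 \<xi> \<alpha> :: real
    and Vx :: "real^'n \<Rightarrow> real" and Vu :: "real^'m \<Rightarrow> real"
  assumes plant: "plant_assumption f g s h"
    and cost: "cost_assumption \<Phi> h"
    and critical: "gradient (reduced_cost \<Phi> h) ustar = 0"
    and xstar: "xstar = s ustar"
    and constants: "c1 > 0" "d1 > 0" "\<mu>1 > 0" "\<theta>1 > 0" "c2 > 0" "d2 > 0" "\<mu>2 > 0" "\<theta>2 > 0" "\<xi> > 0"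
    and Vx_C1: "continuously_differentiable Vx" and Vx_nonneg: "\<And>x. Vx x \<ge> 0"
    and Vu_C1: "continuously_differentiable Vu" and Vu_nonneg: "\<And>u. Vu u \<ge> 0"
    and Vx_bounds: "\<And>x. c1 * (norm (x - xstar))\<^sup>2 \<le> Vx x \<and> Vx x \<le> d1 * (norm (x - xstar))\<^sup>2"
    and Vu_bounds: "\<And>u. c2 * (norm (u - ustar))\<^sup>2 \<le> Vu u \<and> Vu u \<le> d2 * (norm (u - ustar))\<^sup>2"
    and i: "\<And>x u. gradient Vx x \<bullet> f (x, u) \<le> - \<mu>1 * Vx x + \<theta>1 * Vu u"
    and ii: "\<And>x u. - (gradient Vu u \<bullet> Htilde h u (gradient \<Phi> (u, g x))) \<le> - \<mu>2 * Vu u + \<theta>2 * Vx x"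
    and iii: "- \<mu>1 + \<xi> * \<theta>1 < 0" "\<theta>2 - \<xi> * \<mu>2 < 0"
    and alpha: "\<alpha> > 0"
  shows "globally_exponentially_stable (closed_loop f g h \<Phi> \<alpha>) (xstar, ustar) \<and>
    (\<exists>ystar. (\<forall>z. is_solution \<Phi> h z \<longleftrightarrow> z = (ustar, ystar)) \<and>
      (\<forall>x u. solution_on (closed_loop f g h \<Phi> \<alpha>) {0..} (\<lambda>t. (x t, u t))
         \<longrightarrow> ((\<lambda>t. (u t, g (x t))) \<longlongrightarrow> (ustar, ystar)) at_top))"
proof -
  let ?F = "closed_loop f g h \<Phi> \<alpha>" and ?grad = "\<lambda>x u. Htilde h u (gradient \<Phi> (u, g x))"
  have regularity: "locally_lipschitz f" "locally_lipschitz g" "locally_lipschitz (\<lambda>u. jacobian h (at u))"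
      "locally_lipschitz (gradient \<Phi>)" "\<And>z. \<Phi> differentiable (at z)" "\<And>u. h differentiable (at u)"
    and steady: "\<And>u. f (s u, u) = 0" and h: "\<And>u. h u = g (s u)"
    using plant cost continuously_differentiable_imp_differentiable
    unfolding plant_assumption_def cost_assumption_def globally_asymptotically_stable_def by blast+
  note reduced_gradient = GDERIV_reduced_cost[OF regularity(5,6)]
  obtain \<eta> where \<eta>: "0 < \<eta>" "\<eta> * \<theta>2 < \<mu>1" "\<theta>1 < \<eta> * \<mu>2"
    using small_gain_weight constants iii by metis

  \<comment> \<open>At a steady state of both plant and controller, (i) and (ii) have left-hand side \<open>0\<close>.\<close>
  have critical_unique: "u = ustar" if "?grad (s u) u = 0" for u
  proof -
    have "0 \<le> - \<mu>1 * Vx (s u) + \<theta>1 * Vu u" "0 \<le> - \<mu>2 * Vu u + \<theta>2 * Vx (s u)"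
      using i[of "s u" u] ii[of u "s u"] that steady by simp_all
    then have "(\<mu>1 - \<eta> * \<theta>2) * Vx (s u) + (\<eta> * \<mu>2 - \<theta>1) * Vu u \<le> 0"
      using mult_nonneg_nonneg[OF less_imp_le[OF \<eta>(1)], of "- \<mu>2 * Vu u + \<theta>2 * Vx (s u)"]
      by (simp add: algebra_simps)
    moreover have "0 \<le> (\<mu>1 - \<eta> * \<theta>2) * Vx (s u)" using \<eta> Vx_nonneg by simp
    ultimately have "(\<eta> * \<mu>2 - \<theta>1) * Vu u \<le> 0" by linarith
    then have "Vu u \<le> 0" using \<eta>(3) by (simp add: mult_le_0_iff)
    then have "c2 * (norm (u - ustar))\<^sup>2 \<le> 0" using Vu_bounds[of u] by linarith
    then show ?thesis using constants by (simp add: mult_le_0_iff)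
  qed

  have minimizer: "z = (ustar, h ustar)" if "is_solution \<Phi> h z" for z
  proof -
    define u where "u = fst z"
    have arg_min: "snd z = h u \<and> (\<forall>v y. y = h v \<longrightarrow> \<Phi> z \<le> \<Phi> (v, y))"
      using that unfolding is_solution_def is_arg_min_linorder u_def by (simp add: case_prod_beta)
    then have z: "z = (u, h u)" by (simp add: u_def prod_eq_iff)
    have min: "\<Phi> (u, h u) \<le> \<Phi> (v, h v)" for v using arg_min z by simp
    then have "?grad (s u) u = 0"
      using gradient_zero_at_min[OF reduced_gradient[of u]] by (simp add: reduced_cost_def h)
    with z critical_unique show ?thesis by simp
  qed
  then have solution: "is_solution \<Phi> h z \<longleftrightarrow> z = (ustar, h ustar)" for z
    using cost unfolding cost_assumption_def by blast

  \<comment> \<open>Dividing by \<open>\<alpha>\<close> cancels the controller speed, so that \<open>\<eta>\<close> weighs (ii) exactly as it stands.\<close>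
  define V where "V = (\<lambda>(x, u). Vx x + (\<eta> / \<alpha>) * Vu u)"
  define \<sigma> where "\<sigma> = min (\<mu>1 - \<eta> * \<theta>2) (\<alpha> * (\<eta> * \<mu>2 - \<theta>1) / \<eta>)"
  define c where "c = min c1 (\<eta> / \<alpha> * c2)"
  define d where "d = max d1 (\<eta> / \<alpha> * d2)"
  have pos: "0 < \<sigma>" "0 < c" "0 < d"
    using \<eta> alpha constants by (auto simp: \<sigma>_def c_def d_def)
  have norm_split: "(norm (z - (xstar, ustar)))\<^sup>2 = (norm (fst z - xstar))\<^sup>2 + (norm (snd z - ustar))\<^sup>2" for z
    by (cases z) (simp add: norm_prod_def)
  have stable: "globally_exponentially_stable ?F (xstar, ustar)"
  proof (rule globally_exponentially_stable_if_lyapunov[OF _ _ _ _ pos])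
    show "locally_lipschitz ?F" by (intro locally_lipschitz_closed_loop regularity)
    have "?grad xstar ustar = 0"
      using critical gradient_eqI[OF reduced_gradient[of ustar]] by (simp add: h xstar)
    then show "?F (xstar, ustar) = 0" using steady[of ustar] by (simp add: closed_loop_def xstar zero_prod_def)
    show "GDERIV V z :> (gradient Vx (fst z), (\<eta> / \<alpha>) *\<^sub>R gradient Vu (snd z))" for z
      using GDERIV_separable_sum[OF GDERIV_if_continuously_differentiable[OF Vx_C1]
          GDERIV_if_continuously_differentiable[OF Vu_C1], where x="fst z" and u="snd z" and c="\<eta> / \<alpha>"]
      unfolding V_def prod.collapse .
    show "(gradient Vx (fst z), (\<eta> / \<alpha>) *\<^sub>R gradient Vu (snd z)) \<bullet> ?F z \<le> - \<sigma> * V z" for z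
    proof -
      obtain x u where z: "z = (x, u)" by (cases z)
      have "(gradient Vx x, (\<eta> / \<alpha>) *\<^sub>R gradient Vu u) \<bullet> ?F (x, u)
          = gradient Vx x \<bullet> f (x, u) + \<eta> * - (gradient Vu u \<bullet> ?grad x u)"
        using alpha by (simp add: closed_loop_def inner_prod_def)
      also have "\<dots> \<le> (- \<mu>1 * Vx x + \<theta>1 * Vu u) + \<eta> * (- \<mu>2 * Vu u + \<theta>2 * Vx x)"
        using \<eta>(1) by (intro add_mono i mult_left_mono ii) simp
      also have "\<dots> = - ((\<mu>1 - \<eta> * \<theta>2) * Vx x + (\<alpha> * (\<eta> * \<mu>2 - \<theta>1) / \<eta>) * (\<eta> / \<alpha> * Vu u))"
      proof -
        have "(\<alpha> * (\<eta> * \<mu>2 - \<theta>1) / \<eta>) * (\<eta> / \<alpha> * Vu u) = (\<eta> * \<mu>2 - \<theta>1) * Vu u"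
          using \<eta>(1) alpha by simp
        then show ?thesis by (simp add: algebra_simps)
      qed
      also have "\<dots> \<le> - (\<sigma> * Vx x + \<sigma> * (\<eta> / \<alpha> * Vu u))"
        using \<eta>(1) alpha Vx_nonneg Vu_nonneg
        by (intro le_imp_neg_le add_mono mult_right_mono) (auto simp: \<sigma>_def)
      finally show ?thesis by (simp add: z V_def algebra_simps)
    qed
    fix z :: "(real^'n) \<times> (real^'m)"
    obtain x u where z: "z = (x, u)" by (cases z)
    have "c * (norm (x - xstar))\<^sup>2 \<le> c1 * (norm (x - xstar))\<^sup>2" by (intro mult_right_mono) (auto simp: c_def)
    moreover have "c * (norm (u - ustar))\<^sup>2 \<le> \<eta> / \<alpha> * (c2 * (norm (u - ustar))\<^sup>2)"
      unfolding mult.assoc[symmetric] by (intro mult_right_mono) (auto simp: c_def)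
    moreover have "\<eta> / \<alpha> * (c2 * (norm (u - ustar))\<^sup>2) \<le> \<eta> / \<alpha> * Vu u"
      using \<eta>(1) alpha Vu_bounds by (intro mult_left_mono) auto
    ultimately show "c * (norm (z - (xstar, ustar)))\<^sup>2 \<le> V z"
      using Vx_bounds[of x] unfolding norm_split by (simp add: z V_def distrib_left)
    have "d1 * (norm (x - xstar))\<^sup>2 \<le> d * (norm (x - xstar))\<^sup>2" by (intro mult_right_mono) (auto simp: d_def)
    moreover have "\<eta> / \<alpha> * (d2 * (norm (u - ustar))\<^sup>2) \<le> d * (norm (u - ustar))\<^sup>2"
      unfolding mult.assoc[symmetric] by (intro mult_right_mono) (auto simp: d_def)
    moreover have "\<eta> / \<alpha> * Vu u \<le> \<eta> / \<alpha> * (d2 * (norm (u - ustar))\<^sup>2)"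
      using \<eta>(1) alpha Vu_bounds by (intro mult_left_mono) auto
    ultimately show "V z \<le> d * (norm (z - (xstar, ustar)))\<^sup>2"
      using Vx_bounds[of x] unfolding norm_split by (simp add: z V_def distrib_left)
  qed

  have "((\<lambda>t. (u t, g (x t))) \<longlongrightarrow> (ustar, h ustar)) at_top"
    if "solution_on ?F {0..} (\<lambda>t. (x t, u t))" for x u
  proof -
    have lim: "((\<lambda>t. (x t, u t)) \<longlongrightarrow> (xstar, ustar)) at_top"
      using globally_exponentially_stable_tendsto[OF stable that] .
    have x: "(x \<longlongrightarrow> xstar) at_top" and u: "(u \<longlongrightarrow> ustar) at_top"
      using tendsto_fst[OF lim] tendsto_snd[OF lim] by simp_all
    have "isCont g xstar"
      using locally_lipschitz_imp_continuous[OF regularity(2), of UNIV] by (simp add: continuous_on_eq_continuous_at)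
    then have "((\<lambda>t. g (x t)) \<longlongrightarrow> h ustar) at_top"
      using isCont_tendsto_compose[OF _ x] by (simp add: h xstar)
    with u show ?thesis by (rule tendsto_Pair)
  qed
  with stable solution show ?thesis by blast
qed

end
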